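(* Let $d\ge 1$ and $L,n\in\mathbb{N}$, let $z\in\mathcal{S}_{d,L}$, and let $W,W'\in\{F,B\}^n$ be two sequences. Then the set of paths in $\mathcal{S}_{d,L}$ starting from $z$ with direction vector $W$ is in bijection with the set of paths in $\mathcal{S}_{d,L}$ starting from $z$ with direction vector $W'$.
   Context: $\mathbb{N}=\{0,1,2,\dots\}$ and $(e_1,\dots,e_{d+1})$ is the standard basis of $\mathbb{R}^{d+1}$. $\mathcal{S}_{d,L}=\{x_1e_1+\cdots+x_{d+1}e_{d+1} : x_1,\dots,x_{d+1}\in\mathbb{N},\ x_1+\cdots+x_{d+1}=L\}$. Forward steps: $s_j=e_j-e_{j-1}$ for $1\le j\le d+1$, with indices modulo $d+1$ (so $e_0=e_{d+1}$, $s_0=s_{d+1}$); backward steps: $\overline{s_j}=-s_j$. The $2(d+1)$ steps are regarded as distinct symbols (for $d\ge2$ they are distinct vectors). A path of length $n$ in $\mathcal{S}_{d,L}$ starting from $z$ is a sequence $(\omega_1,\dots,\omega_n)$ of forward or backward steps such that $z+\sum_{i=1}^k\omega_i\in\mathcal{S}_{d,L}$ for all $k\in\{0,\dots,n\}$. Its direction vector is $(D_1,\dots,D_n)$ with $D_i=F$ if $\omega_i$ is a forward step and $D_i=B$ if it is a backward step. *)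

theory Defs
  imports Main
begin

(* A vector of R^(d+1) is a function nat => int that vanishes outside {1..d+1}.
   Integer coordinates suffice, since points of the simplex and steps are integral. *)
type_synonym vect = "nat \<Rightarrow> int"

(* Only the residue of j modulo d+1 matters; in particular e_0 = e_(d+1). *)
definition basis_vec :: "nat \<Rightarrow> nat \<Rightarrow> vect" where
  "basis_vec d j = (\<lambda>i. if i \<in> {1..d+1} \<and> i mod (d+1) = j mod (d+1) then 1 else 0)"

definition simplex :: "nat \<Rightarrow> nat \<Rightarrow> vect set" where
  "simplex d L = {x. (\<forall>i\<in>{1..d+1}. 0 \<le> x i) \<and> (\<forall>i. i \<notin> {1..d+1} \<longrightarrow> x i = 0)
                     \<and> (\<Sum>i=1..d+1. x i) = int L}"

(* Fwd j and Bwd j are the symbols s_j and -s_j. They stay distinct even for d = 1,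
   where -s_1 and s_2 are the same vector. *)
datatype step = Fwd nat | Bwd nat

definition steps :: "nat \<Rightarrow> step set" where
  "steps d = Fwd ` {1..d+1} \<union> Bwd ` {1..d+1}"

definition forward_vec :: "nat \<Rightarrow> nat \<Rightarrow> vect" where
  "forward_vec d j = (\<lambda>i. basis_vec d j i - basis_vec d (j - 1) i)"

fun step_vec :: "nat \<Rightarrow> step \<Rightarrow> vect" where
  "step_vec d (Fwd j) = forward_vec d j"
| "step_vec d (Bwd j) = (\<lambda>i. - forward_vec d j i)"

definition position :: "nat \<Rightarrow> vect \<Rightarrow> step list \<Rightarrow> vect" where
  "position d z \<omega> = (\<lambda>i. z i + (\<Sum>s\<leftarrow>\<omega>. step_vec d s i))"

definition paths :: "nat \<Rightarrow> nat \<Rightarrow> nat \<Rightarrow> vect \<Rightarrow> step list set" where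
  "paths d L n z = {\<omega>. length \<omega> = n \<and> set \<omega> \<subseteq> steps d
                        \<and> (\<forall>k\<in>{0..n}. position d z (take k \<omega>) \<in> simplex d L)}"

datatype direction = F | B

fun direction_of :: "step \<Rightarrow> direction" where
  "direction_of (Fwd j) = F"
| "direction_of (Bwd j) = B"

definition direction_vector :: "step list \<Rightarrow> direction list" where
  "direction_vector \<omega> = map direction_of \<omega>"

end

(* Let T F and T B be the forward and backward adjacency operators acting on functions on the
   simplex, so that the number of paths with direction vector W starting from z is the value at z
   of T W_1 (... (T W_n 1)). Two facts make this depend on the length of W only. First, T F 1 = T B 1:
   from x, both the number of forward steps and the number of backward steps are the number of
   nonzero coordinates of x. Second, T F and T B commute: for i \<noteq> j, if x and x + s_i - s_j lie
   in the simplex, then so do x + s_i and x - s_j; and the pairs with i = j, which return to x,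
   are counted equally by the first fact. *)
theory Submission
  imports Defs
begin

fun step_of :: "direction \<Rightarrow> nat \<Rightarrow> step" where
  "step_of F j = Fwd j"
| "step_of B j = Bwd j"

definition shift :: "nat \<Rightarrow> direction \<Rightarrow> nat \<Rightarrow> vect \<Rightarrow> vect" where
  "shift d D j x = (\<lambda>i. x i + step_vec d (step_of D j) i)"

text \<open>Coordinates live in {1..d+1}, so the index 0 occurring in s_1 has to be represented by d
  + 1.\<close>

definition cyc_pred :: "nat \<Rightarrow> nat \<Rightarrow> nat" where
  "cyc_pred d j = (if j = 1 then d + 1 else j - 1)"

text \<open>Only the current point is tested, not the point reached. This is therefore the adjacency
  operator of the simplex only on functions g that vanish outside it.\<close>

definition adj_op :: "nat \<Rightarrow> nat \<Rightarrow> direction \<Rightarrow> (vect \<Rightarrow> nat) \<Rightarrow> vect \<Rightarrow> nat" where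
  "adj_op d L D g x = (if x \<in> simplex d L then \<Sum>j=1..d+1. g (shift d D j x) else 0)"

abbreviation simplex_indicator :: "nat \<Rightarrow> nat \<Rightarrow> vect \<Rightarrow> nat" where
  "simplex_indicator d L x \<equiv> of_bool (x \<in> simplex d L)"

definition directed_paths :: "nat \<Rightarrow> nat \<Rightarrow> direction list \<Rightarrow> vect \<Rightarrow> step list set" where
  "directed_paths d L W z = {\<omega> \<in> paths d L (length W) z. direction_vector \<omega> = W}"

section \<open>Cyclic indices, coordinates of steps, and steps that stay in the simplex\<close>

lemma cyc_pred_in: "j \<in> {1..d+1} \<Longrightarrow> cyc_pred d j \<in> {1..d+1}"
  by (auto simp: cyc_pred_def)

lemma bij_betw_cyc_pred: "bij_betw (cyc_pred d) {1..d+1} {1..d+1}"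
proof -
  have "inj_on (cyc_pred d) {1..d+1}"
    by (auto simp: inj_on_def cyc_pred_def split: if_splits)
  moreover have "cyc_pred d ` {1..d+1} \<subseteq> {1..d+1}"
    using cyc_pred_in by blast
  ultimately show ?thesis
    by (simp add: bij_betw_def endo_inj_surj)
qed

text \<open>Here d \<ge> 1 enters: for d = 0 the only index is its own predecessor and the forward
  step is the zero vector.\<close>

lemma cyc_pred_neq: "d \<ge> 1 \<Longrightarrow> j \<in> {1..d+1} \<Longrightarrow> cyc_pred d j \<noteq> j"
  by (auto simp: cyc_pred_def)

lemma mod_Suc_eq_iff:
  fixes i j d :: nat
  assumes "i \<in> {1..d+1}" "j \<in> {1..d+1}"
  shows "i mod (d+1) = j mod (d+1) \<longleftrightarrow> i = j"
  using assms by (cases "i = d+1"; cases "j = d+1") auto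

lemma basis_vec_eq: "j \<in> {1..d+1} \<Longrightarrow> basis_vec d j i = of_bool (i = j)"
  using mod_Suc_eq_iff[of i d j] by (auto simp: basis_vec_def)

lemma basis_vec_pred: "basis_vec d (j - 1) = basis_vec d (cyc_pred d j)"
  by (auto simp: cyc_pred_def basis_vec_def)

lemma forward_vec_eq:
  assumes "j \<in> {1..d+1}"
  shows "forward_vec d j i = of_bool (i = j) - of_bool (i = cyc_pred d j)"
  using basis_vec_eq[OF assms] basis_vec_eq[OF cyc_pred_in[OF assms]]
  by (simp add: forward_vec_def basis_vec_pred[of d j, simplified])

lemma step_vec_outside:
  assumes "j \<in> {1..d+1}" "i \<notin> {1..d+1}"
  shows "step_vec d (step_of D j) i = 0"
  using assms cyc_pred_in[of j d] by (cases D) (auto simp: forward_vec_eq)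

lemma sum_step_vec:
  assumes "j \<in> {1..d+1}"
  shows "(\<Sum>i=1..d+1. step_vec d (step_of D j) i) = 0"
proof -
  have "(\<Sum>i=1..d+1. forward_vec d j i) = 0"
    using assms cyc_pred_in[OF assms]
    by (simp only: forward_vec_eq[OF assms] sum_subtractf of_bool_def sum.delta) simp
  then show ?thesis by (cases D) (simp_all add: sum_negf)
qed

text \<open>A step changes neither the coordinate sum nor the zeros outside {1..d+1}, so only
  nonnegativity can fail.\<close>

lemma shift_in_simplex_iff:
  assumes "x \<in> simplex d L" "j \<in> {1..d+1}"
  shows "shift d D j x \<in> simplex d L \<longleftrightarrow> (\<forall>i\<in>{1..d+1}. 0 \<le> shift d D j x i)"
proof -
  have "(\<Sum>i=1..d+1. shift d D j x i) = int L"
    using assms sum_step_vec[OF assms(2), of D]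
    by (simp only: shift_def sum.distrib simplex_def mem_Collect_eq)
  moreover have "\<forall>i. i \<notin> {1..d+1} \<longrightarrow> shift d D j x i = 0"
    using assms step_vec_outside[OF assms(2)] by (simp add: shift_def simplex_def)
  ultimately show ?thesis by (simp only: simplex_def mem_Collect_eq) blast
qed

text \<open>The only coordinate that s_j lowers is \<open>cyc_pred d j\<close>, and it is lowered by
  exactly 1 because it differs from the raised coordinate j. For -s_j the two coordinates exchange
  roles.\<close>

lemma shift_F_in_simplex_iff:
  assumes "d \<ge> 1" "x \<in> simplex d L" "j \<in> {1..d+1}"
  shows "shift d F j x \<in> simplex d L \<longleftrightarrow> 1 \<le> x (cyc_pred d j)"
proof -
  have "\<forall>i\<in>{1..d+1}. 0 \<le> x i" using assms by (simp add: simplex_def)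
  then show ?thesis
    unfolding shift_in_simplex_iff[OF assms(2,3)]
    using assms(3) cyc_pred_in[OF assms(3)] cyc_pred_neq[OF assms(1,3)]
    by (force simp: shift_def forward_vec_eq of_bool_def)
qed

lemma shift_B_in_simplex_iff:
  assumes "d \<ge> 1" "x \<in> simplex d L" "j \<in> {1..d+1}"
  shows "shift d B j x \<in> simplex d L \<longleftrightarrow> 1 \<le> x j"
proof -
  have "\<forall>i\<in>{1..d+1}. 0 \<le> x i" using assms by (simp add: simplex_def)
  then show ?thesis
    unfolding shift_in_simplex_iff[OF assms(2,3)]
    using assms(3) cyc_pred_neq[OF assms(1,3)]
    by (force simp: shift_def forward_vec_eq of_bool_def)
qed

lemma shift_commute: "shift d D i (shift d D' j x) = shift d D' j (shift d D i x)"
  by (auto simp: shift_def)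

lemma shift_B_F_cancel: "shift d B j (shift d F j x) = x"
  by (auto simp: shift_def)

text \<open>The two steps lower the coordinates \<open>cyc_pred d i\<close> and j, and raise i and
  \<open>cyc_pred d j\<close>. For i \<noteq> j no raised coordinate is a lowered one, so
  nonnegativity at the end point forces both lowered coordinates to be at least 1 already at
  x.\<close>

lemma intermediate_in_simplex:
  assumes "d \<ge> 1" "x \<in> simplex d L" "i \<in> {1..d+1}" "j \<in> {1..d+1}" "i \<noteq> j"
    and "shift d B j (shift d F i x) \<in> simplex d L"
  shows "shift d F i x \<in> simplex d L" "shift d B j x \<in> simplex d L"
proof -
  have nonneg: "0 \<le> shift d B j (shift d F i x) k" if "k \<in> {1..d+1}" for k
    using assms(6) that by (simp add: simplex_def)
  have "cyc_pred d i \<noteq> cyc_pred d j"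
    using bij_betw_cyc_pred[of d] assms(3-5) by (auto simp: bij_betw_def inj_on_def)
  then show "shift d F i x \<in> simplex d L"
    using nonneg[OF cyc_pred_in[OF assms(3)]] cyc_pred_neq[OF assms(1,3)]
    unfolding shift_F_in_simplex_iff[OF assms(1-3)]
    by (simp add: shift_def forward_vec_eq[OF assms(3)]
        forward_vec_eq[OF assms(4)] of_bool_def split: if_splits)
  show "shift d B j x \<in> simplex d L"
    using nonneg[OF assms(4)] assms(5) cyc_pred_neq[OF assms(1,4)]
    unfolding shift_B_in_simplex_iff[OF assms(1,2,4)]
    by (simp add: shift_def forward_vec_eq[OF assms(3)]
        forward_vec_eq[OF assms(4)] of_bool_def split: if_splits)
qed

section \<open>The two operators agree on the indicator and commute\<close>

lemma adj_op_indicator: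
  assumes "d \<ge> 1"
  shows "adj_op d L F (simplex_indicator d L) = adj_op d L B (simplex_indicator d L)"
proof
  fix x
  show "adj_op d L F (simplex_indicator d L) x = adj_op d L B (simplex_indicator d L) x"
  proof (cases "x \<in> simplex d L")
    case True
    have "(\<Sum>j=1..d+1. simplex_indicator d L (shift d F j x)) = (\<Sum>j=1..d+1. of_bool (1 \<le> x (cyc_pred d j)))"
      using shift_F_in_simplex_iff[OF assms True] by (intro sum.cong) auto
    \<comment> \<open>Each forward step is relabelled by the coordinate it lowers;
      \<open>cyc_pred d\<close> permutes the indices.\<close>
    also have "\<dots> = (\<Sum>j=1..d+1. of_bool (1 \<le> x j))"
      by (rule sum.reindex_bij_betw[OF bij_betw_cyc_pred])
    also have "\<dots> = (\<Sum>j=1..d+1. simplex_indicator d L (shift d B j x))"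
      using shift_B_in_simplex_iff[OF assms True] by (intro sum.cong) auto
    finally show ?thesis using True by (simp add: adj_op_def)
  qed (simp add: adj_op_def)
qed

text \<open>Needed because the two orders of stepping agree term by term off the diagonal, but on
  the diagonal only in total.\<close>

lemma sum_sum_split_diagonal:
  fixes h :: "'a \<Rightarrow> 'a \<Rightarrow> 'b::comm_monoid_add"
  assumes "finite I"
  shows "(\<Sum>i\<in>I. \<Sum>j\<in>I. h i j) = (\<Sum>i\<in>I. h i i) + (\<Sum>i\<in>I. \<Sum>j\<in>I. if i = j then 0 else h i j)"
proof -
  have "(\<Sum>j\<in>I. h i j) = h i i + (\<Sum>j\<in>I. if i = j then 0 else h i j)" if "i \<in> I" for i
  proof -
    have "(\<Sum>j\<in>I. h i j) = (\<Sum>j\<in>I. (if i = j then h i j else 0) + (if i = j then 0 else h i j))"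
      by (intro sum.cong) auto
    also have "\<dots> = h i i + (\<Sum>j\<in>I. if i = j then 0 else h i j)"
      using that assms by (simp only: sum.distrib sum.delta) simp
    finally show ?thesis .
  qed
  then show ?thesis by (simp add: sum.distrib)
qed

lemma adj_op_commute:
  assumes d: "d \<ge> 1" and g: "\<And>x. x \<notin> simplex d L \<Longrightarrow> g x = 0"
  shows "adj_op d L F (adj_op d L B g) = adj_op d L B (adj_op d L F g)"
proof
  fix x
  show "adj_op d L F (adj_op d L B g) x = adj_op d L B (adj_op d L F g) x"
  proof (cases "x \<in> simplex d L")
    case x: True
    define I where "I = {1..d+1}"
    \<comment> \<open>In \<open>h\<close> and \<open>h'\<close> the first argument belongs to the
      step taken first, and i is always the index of the forward step. The test is the one made by
      the inner operator at the intermediate point.\<close>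
    define h where "h i j = (if shift d F i x \<in> simplex d L then g (shift d B j (shift d F i x)) else 0)" for i j
    define h' where "h' j i = (if shift d B j x \<in> simplex d L then g (shift d F i (shift d B j x)) else 0)" for i j
    \<comment> \<open>Every admissible first step followed by its reversal contributes g x, so each
      total is g x times the number of admissible first steps, and \<open>adj_op_indicator\<close>
      equates these numbers.\<close>
    have diag: "(\<Sum>i\<in>I. h i i) = (\<Sum>i\<in>I. h' i i)"
    proof -
      have "(\<Sum>i\<in>I. h i i) = (\<Sum>i\<in>I. simplex_indicator d L (shift d F i x)) * g x"
        by (auto simp: h_def shift_B_F_cancel sum_distrib_right intro!: sum.cong)
      also have "\<dots> = (\<Sum>i\<in>I. simplex_indicator d L (shift d B i x)) * g x"
        using fun_cong[OF adj_op_indicator[OF d, of L], of x] x by (simp add: adj_op_def I_def)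
      also have "\<dots> = (\<Sum>i\<in>I. h' i i)"
        by (auto simp: h'_def shift_B_F_cancel shift_commute[of d F] sum_distrib_right intro!: sum.cong)
      finally show ?thesis .
    qed
    \<comment> \<open>If the common end point lies in the simplex, so do both intermediate points;
      otherwise g vanishes there and both terms are 0.\<close>
    have off: "h i j = h' j i" if "i \<in> I" "j \<in> I" "i \<noteq> j" for i j
      using intermediate_in_simplex[OF d x _ _ that(3)] that(1,2) g
      by (fastforce simp: h_def h'_def I_def shift_commute[of d F])
    have "adj_op d L F (adj_op d L B g) x = (\<Sum>i\<in>I. \<Sum>j\<in>I. h i j)"
      using x by (auto simp: adj_op_def h_def I_def intro!: sum.cong)
    also have "\<dots> = (\<Sum>i\<in>I. h i i) + (\<Sum>i\<in>I. \<Sum>j\<in>I. if i = j then 0 else h i j)"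
      by (rule sum_sum_split_diagonal) (simp add: I_def)
    also have "(\<Sum>i\<in>I. \<Sum>j\<in>I. if i = j then 0 else h i j) = (\<Sum>i\<in>I. \<Sum>j\<in>I. if j = i then 0 else h' j i)"
      by (intro sum.cong refl) (auto simp: off)
    also have "\<dots> = (\<Sum>j\<in>I. \<Sum>i\<in>I. if j = i then 0 else h' j i)"
      by (rule sum.swap)
    also have "(\<Sum>i\<in>I. h i i) + \<dots> = (\<Sum>j\<in>I. \<Sum>i\<in>I. h' j i)"
      unfolding diag by (rule sum_sum_split_diagonal[symmetric]) (simp add: I_def)
    also have "\<dots> = adj_op d L B (adj_op d L F g) x"
      using x by (auto simp: adj_op_def h'_def I_def intro!: sum.cong)
    finally show ?thesis .
  qed (simp add: adj_op_def)
qed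

text \<open>Supplies the vanishing hypothesis of \<open>adj_op_commute\<close> for the
  iterates.\<close>

lemma funpow_adj_op_outside:
  "x \<notin> simplex d L \<Longrightarrow> (adj_op d L D ^^ n) (simplex_indicator d L) x = 0"
  by (cases n) (simp_all add: adj_op_def)

text \<open>The backward operator moves inward past all forward ones until it meets the indicator,
  where it may be replaced by a forward one.\<close>

lemma adj_op_B_funpow:
  assumes "d \<ge> 1"
  shows "adj_op d L B ((adj_op d L F ^^ n) (simplex_indicator d L))
    = (adj_op d L F ^^ Suc n) (simplex_indicator d L)"
proof (induction n)
  case 0
  show ?case using adj_op_indicator[OF assms, of L] by simp
next
  case (Suc n)
  have "adj_op d L B ((adj_op d L F ^^ Suc n) (simplex_indicator d L))
    = adj_op d L F (adj_op d L B ((adj_op d L F ^^ n) (simplex_indicator d L)))"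
    using adj_op_commute[OF assms funpow_adj_op_outside] by simp
  then show ?case by (simp add: Suc)
qed

text \<open>The letters of W are turned into F from the last to the first: behind the current letter
  there is already a pure power of the forward operator.\<close>

lemma foldr_adj_op:
  assumes "d \<ge> 1"
  shows "foldr (adj_op d L) W (simplex_indicator d L)
    = (adj_op d L F ^^ length W) (simplex_indicator d L)"
proof (induction W)
  case (Cons D W)
  then show ?case using adj_op_B_funpow[OF assms] by (cases D) simp_all
qed simp

section \<open>Splitting off the first step of a path, and counting\<close>

lemma position_Cons: "position d z (step_of D j # \<omega>) = position d (shift d D j z) \<omega>"
  by (auto simp: position_def shift_def)

lemma ball_atLeastAtMost_Suc:
  "(\<forall>k\<in>{0..Suc n}. P k) \<longleftrightarrow> P 0 \<and> (\<forall>k\<in>{0..n}. P (Suc k))"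
  unfolding atLeast0_atMost_Suc_eq_insert_0 by blast

lemma directed_paths_Nil:
  "directed_paths d L [] z = (if z \<in> simplex d L then {[]} else {})"
  by (auto simp: directed_paths_def paths_def position_def direction_vector_def)

lemma Cons_in_directed_paths:
  "s # \<omega> \<in> directed_paths d L (D # W) z \<longleftrightarrow>
    z \<in> simplex d L \<and> (\<exists>j\<in>{1..d+1}. s = step_of D j \<and> \<omega> \<in> directed_paths d L W (shift d D j z))"
proof -
  have "s \<in> steps d \<and> direction_of s = D \<longleftrightarrow> (\<exists>j\<in>{1..d+1}. s = step_of D j)"
    by (cases s; cases D) (auto simp: steps_def)
  moreover have "position d z [] = z" by (simp add: position_def)
  ultimately show ?thesis
    unfolding directed_paths_def paths_def direction_vector_def
    by (auto simp del: atLeastAtMost_iff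
        simp: ball_atLeastAtMost_Suc position_Cons)
qed

lemma directed_paths_Cons:
  "directed_paths d L (D # W) z = (if z \<in> simplex d L
    then \<Union>j\<in>{1..d+1}. (#) (step_of D j) ` directed_paths d L W (shift d D j z) else {})"
proof -
  have "[] \<notin> directed_paths d L (D # W) z"
    by (simp add: directed_paths_def direction_vector_def)
  then have "\<omega> \<in> directed_paths d L (D # W) z \<longleftrightarrow> z \<in> simplex d L \<and>
      \<omega> \<in> (\<Union>j\<in>{1..d+1}. (#) (step_of D j) ` directed_paths d L W (shift d D j z))" for \<omega>
    by (cases \<omega>) (auto simp: Cons_in_directed_paths simp del: atLeastAtMost_iff)
  then show ?thesis by auto
qed

lemma step_of_inject: "step_of D i = step_of D j \<longleftrightarrow> i = j"
  by (cases D) auto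

text \<open>The start z is arbitrary because the induction passes to shifted points that may leave
  the simplex, where both sides are 0. Finiteness is carried along for the cardinality of the
  union.\<close>

lemma finite_card_directed_paths:
  "finite (directed_paths d L W z) \<and>
    card (directed_paths d L W z) = foldr (adj_op d L) W (simplex_indicator d L) z"
proof (induction W arbitrary: z)
  case Nil
  show ?case by (simp add: directed_paths_Nil)
next
  case (Cons D W)
  \<comment> \<open>The union is disjoint since different j give different first steps.\<close>
  have "card (\<Union>j\<in>{1..d+1}. (#) (step_of D j) ` directed_paths d L W (shift d D j z))
    = (\<Sum>j=1..d+1. card ((#) (step_of D j) ` directed_paths d L W (shift d D j z)))"
    using Cons by (intro card_UN_disjoint) (auto simp: step_of_inject)
  also have "\<dots> = (\<Sum>j=1..d+1. foldr (adj_op d L) W (simplex_indicator d L) (shift d D j z))"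
    using Cons by (simp add: card_image)
  finally show ?case
    using Cons by (simp add: directed_paths_Cons adj_op_def[of d L D])
qed

theorem theorem33:
  fixes d L n :: nat and z :: vect and W W' :: "direction list"
  assumes "d \<ge> 1" and "z \<in> simplex d L" and "length W = n" and "length W' = n"
  shows "\<exists>f. bij_betw f {\<omega> \<in> paths d L n z. direction_vector \<omega> = W}
                        {\<omega> \<in> paths d L n z. direction_vector \<omega> = W'}"
proof -
  \<comment> \<open>Both numbers are the value at z of the n-th power of the forward operator
    applied to the indicator.\<close>
  have "card (directed_paths d L W z) = card (directed_paths d L W' z)"
    using assms by (simp add: finite_card_directed_paths foldr_adj_op)
  then have "\<exists>f. bij_betw f (directed_paths d L W z) (directed_paths d L W' z)"
    by (simp add: finite_same_card_bij finite_card_directed_paths)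
  then show ?thesis using assms(3,4) by (simp add: directed_paths_def)
qed

end
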